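(* Let $(X,\mu)$ be a probability space, let $\kappa\in\mathcal{K}^+(\mu)\cap\mathcal{K}_0(\mu)$ be a distance, and let $\sigma\in\mathcal{K}^+(\mu)$. Then the function $\kappa:(X\times X,\ \rho_\sigma\oplus\rho_\sigma)\to[0,\infty)$ is Lipschitz if and only if the map $\iota_\sigma:(X,\kappa)\to L^2(\mu)$ is lower Lipschitz. In this case, we have $\operatorname{Lip}(\kappa)=\operatorname{Lip}\big(\iota_\sigma^{-1}:\iota_\sigma(X)\to X\big)$.
   Context: $\mathcal{K}(\mu)$ is the set of $\mu\times\mu$-measurable functions $\kappa:X\times X\to\mathbb{R}$ with $\iint\kappa^2(x,y)\,d\mu(x)\,d\mu(y)<\infty$ (so that $\kappa(x,-)\in L^2(\mu)$ for $\mu$-almost every $x$); $\mathcal{K}^+(\mu)$ is the subset of those with $\kappa(x,y)\ge0$ for all $x,y\in X$, and $\mathcal{K}_0(\mu)$ the subset of those with $\kappa(x,x)=0$ for all $x\in X$. A distance is a function $\kappa:X\times X\to\mathbb{R}$ with $\kappa\ge 0$ and $\kappa(x,z)\le\kappa(x,y)+\kappa(y,z)$ for all $x,y,z\in X$ (not necessarily symmetric). The canonical map is $\iota_\sigma:X\to L^2(\mu)$, $\iota_\sigma(x)=\sigma(x,-)$, and $\rho_\sigma(x,y)=\|\iota_\sigma(x)-\iota_\sigma(y)\|_2$ is the pseudometric it induces on $X$. The map $\iota_\sigma:(X,\kappa)\to L^2(\mu)$ is lower Lipschitz if there is $\ell>0$ with $\ell\,[\kappa(x,y)\vee\kappa(y,x)]\le\|\iota_\sigma(x)-\iota_\sigma(y)\|_2$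 for all $x,y\in X$, where $\vee$ denotes maximum. $\operatorname{Lip}(\iota_\sigma^{-1}:\iota_\sigma(X)\to X)$ is the smallest $L\ge0$ with $\kappa(x,y)\le L\,\|\iota_\sigma(x)-\iota_\sigma(y)\|_2$ for all $x,y\in X$. For a pseudometric $\rho$ on $X$, $\rho\oplus\rho$ denotes any one of the bi-Lipschitz equivalent pseudometrics on $X\times X$ whose value at $((x,y),(x',y'))$ is $\max\{\rho(x,x'),\rho(y,y')\}$ or $(\rho(x,x')^p+\rho(y,y')^p)^{1/p}$, $1\le p<\infty$. The interval $[0,\infty)$ has the usual metric, and $\operatorname{Lip}(\kappa)$ is the smallest Lipschitz constant of $\kappa$ on $X\times X$ with respect to $\rho_\sigma\oplus\rho_\sigma$.
   Formalization: The equality Lip(κ) = Lip(ι_σ^{-1}) is stated only for the sum ρ_σ⊕ρ_σ (p = 1), since it fails in general for the maximum and for every p > 1; the equivalence is stated for all choices; ι_σ(x) is set to 0 where σ(x,-) is not in L^2(μ). *)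

theory Defs
  imports "HOL-Probability.Probability"
begin

definition kernels :: "'a measure \<Rightarrow> ('a \<Rightarrow> 'a \<Rightarrow> real) set" where
  "kernels M = {k. case_prod k \<in> borel_measurable (M \<Otimes>\<^sub>M M) \<and>
                   (\<integral>\<^sup>+ y. \<integral>\<^sup>+ x. ennreal ((k x y)\<^sup>2) \<partial>M \<partial>M) < \<infinity>}"

definition nonneg_kernels :: "'a measure \<Rightarrow> ('a \<Rightarrow> 'a \<Rightarrow> real) set" where
  "nonneg_kernels M = {k \<in> kernels M. \<forall>x\<in>space M. \<forall>y\<in>space M. 0 \<le> k x y}"

definition diag0_kernels :: "'a measure \<Rightarrow> ('a \<Rightarrow> 'a \<Rightarrow> real) set" where
  "diag0_kernels M = {k \<in> kernels M. \<forall>x\<in>space M. k x x = 0}"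

definition is_distance :: "'a set \<Rightarrow> ('a \<Rightarrow> 'a \<Rightarrow> real) \<Rightarrow> bool" where
  "is_distance X k \<longleftrightarrow>
     (\<forall>x\<in>X. \<forall>y\<in>X. 0 \<le> k x y) \<and>
     (\<forall>x\<in>X. \<forall>y\<in>X. \<forall>z\<in>X. k x z \<le> k x y + k y z)"

text \<open>Elements of $L^2(\mu)$ are represented by square-integrable functions; the norm below is
  the $L^2$ norm of the class of \<open>f\<close> modulo equality almost everywhere.\<close>

definition L2_functions :: "'a measure \<Rightarrow> ('a \<Rightarrow> real) set" where
  "L2_functions M = {f \<in> borel_measurable M. integrable M (\<lambda>y. (f y)\<^sup>2)}"

definition L2_norm :: "'a measure \<Rightarrow> ('a \<Rightarrow> real) \<Rightarrow> real" where
  "L2_norm M f = sqrt (\<integral>y. (f y)\<^sup>2 \<partial>M)"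

text \<open>For a kernel \<open>s\<close> the section \<open>s x\<close> is in $L^2(\mu)$ only for almost every \<open>x\<close>. On the
  exceptional null set the canonical map takes the value \<open>0\<close>, so that it is a map
  from all of \<open>X\<close> to $L^2(\mu)$ (and is given by \<open>x \<mapsto> s x\<close> if all sections are in $L^2(\mu)$).\<close>

definition canonical_map :: "'a measure \<Rightarrow> ('a \<Rightarrow> 'a \<Rightarrow> real) \<Rightarrow> 'a \<Rightarrow> 'a \<Rightarrow> real" where
  "canonical_map M s x = (if s x \<in> L2_functions M then s x else (\<lambda>_. 0))"

definition rho :: "'a measure \<Rightarrow> ('a \<Rightarrow> 'a \<Rightarrow> real) \<Rightarrow> 'a \<Rightarrow> 'a \<Rightarrow> real" where
  "rho M s x y = L2_norm M (\<lambda>z. canonical_map M s x z - canonical_map M s y z)"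

definition lower_Lipschitz :: "'a measure \<Rightarrow> ('a \<Rightarrow> 'a \<Rightarrow> real) \<Rightarrow> ('a \<Rightarrow> 'a \<Rightarrow> real) \<Rightarrow> bool" where
  "lower_Lipschitz M k s \<longleftrightarrow>
     (\<exists>l>0. \<forall>x\<in>space M. \<forall>y\<in>space M. l * max (k x y) (k y x) \<le> rho M s x y)"

definition Lip_inverse :: "'a measure \<Rightarrow> ('a \<Rightarrow> 'a \<Rightarrow> real) \<Rightarrow> ('a \<Rightarrow> 'a \<Rightarrow> real) \<Rightarrow> real" where
  "Lip_inverse M k s =
     (LEAST L. 0 \<le> L \<and> (\<forall>x\<in>space M. \<forall>y\<in>space M. k x y \<le> L * rho M s x y))"

text \<open>The pseudometrics \<open>\<rho> \<oplus> \<rho>\<close> on $X \times X$ are bi-Lipschitz equivalent, so being Lipschitz does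
  not depend on the choice, but the smallest Lipschitz constant does. The identity
  \<open>Lip(\<kappa>) = Lip(\<iota>\<^sub>\<sigma>\<inverse>)\<close> is about the sum \<open>oplus_p 1\<close>: it already fails for \<open>oplus_max\<close> when \<open>\<kappa>\<close>
  and \<open>\<rho>\<^sub>\<sigma>\<close> are the usual metric of $[0,\infty)$, as \<open>\<kappa>(0,2) - \<kappa>(1,1) = 2\<close> while
  both coordinates move by \<open>1\<close>.\<close>

definition oplus_max :: "('a \<Rightarrow> 'a \<Rightarrow> real) \<Rightarrow> 'a \<times> 'a \<Rightarrow> 'a \<times> 'a \<Rightarrow> real" where
  "oplus_max r u v = max (r (fst u) (fst v)) (r (snd u) (snd v))"

definition oplus_p :: "real \<Rightarrow> ('a \<Rightarrow> 'a \<Rightarrow> real) \<Rightarrow> 'a \<times> 'a \<Rightarrow> 'a \<times> 'a \<Rightarrow> real" where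
  "oplus_p p r u v = (r (fst u) (fst v) powr p + r (snd u) (snd v) powr p) powr (1 / p)"

definition oplus_pseudometrics :: "('a \<Rightarrow> 'a \<Rightarrow> real) \<Rightarrow> ('a \<times> 'a \<Rightarrow> 'a \<times> 'a \<Rightarrow> real) set" where
  "oplus_pseudometrics r = {oplus_max r} \<union> {oplus_p p r | p. 1 \<le> p}"

text \<open>The library's \<open>lipschitz_on\<close> refers to the distance of a metric type class; here the
  domain carries an arbitrary pseudometric \<open>d\<close>.\<close>

definition Lipschitz_const :: "'b set \<Rightarrow> ('b \<Rightarrow> 'b \<Rightarrow> real) \<Rightarrow> ('b \<Rightarrow> real) \<Rightarrow> real \<Rightarrow> bool" where
  "Lipschitz_const S d f L \<longleftrightarrow> 0 \<le> L \<and> (\<forall>u\<in>S. \<forall>v\<in>S. dist (f u) (f v) \<le> L * d u v)"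

definition is_Lipschitz :: "'b set \<Rightarrow> ('b \<Rightarrow> 'b \<Rightarrow> real) \<Rightarrow> ('b \<Rightarrow> real) \<Rightarrow> bool" where
  "is_Lipschitz S d f \<longleftrightarrow> (\<exists>L. Lipschitz_const S d f L)"

definition Lip :: "'b set \<Rightarrow> ('b \<Rightarrow> 'b \<Rightarrow> real) \<Rightarrow> ('b \<Rightarrow> real) \<Rightarrow> real" where
  "Lip S d f = (LEAST L. Lipschitz_const S d f L)"

text \<open>The smallest constants above exist whenever any constant does, provided the pseudometric
  is nonnegative.\<close>

lemma least_constant_exists:
  fixes a b :: "'i \<Rightarrow> real"
  assumes "0 \<le> L" "\<forall>i\<in>I. a i \<le> L * b i" "\<forall>i\<in>I. 0 \<le> b i"
  defines "P \<equiv> \<lambda>L. 0 \<le> L \<and> (\<forall>i\<in>I. a i \<le> L * b i)"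
  shows "P (LEAST L. P L)" "P K \<Longrightarrow> (LEAST L. P L) \<le> K"
proof -
  define m where "m = Inf {L. P L}"
  have ne: "{L. P L} \<noteq> {}" using assms by (auto simp: P_def)
  have bdd: "bdd_below {L. P L}" by (rule bdd_belowI[of _ 0]) (auto simp: P_def)
  have low: "m \<le> K" if "P K" for K
    unfolding m_def using that bdd by (intro cInf_lower) auto
  have "0 \<le> m" unfolding m_def using ne by (intro cInf_greatest) (auto simp: P_def)
  moreover have "a i \<le> m * b i" if i: "i \<in> I" for i
  proof (cases "b i = 0")
    case True
    then show ?thesis using assms(2) i by fastforce
  next
    case False
    then have pos: "0 < b i" using assms(3) i by force
    have "a i / b i \<le> m" unfolding m_def
      using ne by (rule cInf_greatest) (use i pos in \<open>auto simp: P_def field_simps\<close>)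
    then show ?thesis using pos by (simp add: field_simps)
  qed
  ultimately have Pm: "P m" by (auto simp: P_def)
  then have eq: "(LEAST L. P L) = m" by (intro Least_equality low)
  show "P (LEAST L. P L)" using Pm eq by simp
  show "(LEAST L. P L) \<le> K" if "P K" using low[OF that] eq by simp
qed

end

theory Submission imports Defs begin

text \<open>
  Both properties say that \<open>\<kappa>\<close> is dominated by a multiple of \<open>\<rho>\<^sub>\<sigma>\<close>, that is,
  \<open>\<kappa>(x,y) \<le> L \<rho>\<^sub>\<sigma>(x,y)\<close> for all \<open>x\<close>, \<open>y\<close>. A Lipschitz bound for \<open>\<kappa>\<close> between \<open>(x,y)\<close> and the
  diagonal point \<open>(y,y)\<close> is exactly such a bound: there \<open>\<kappa>(y,y) = 0\<close>, and each of the
  pseudometrics \<open>\<rho> \<oplus> \<rho>\<close> takes the value \<open>\<rho>(x,y)\<close> because only one coordinate moves. Conversely,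
  two triangle inequalities give
  \<open>\<kappa>(x,y) - \<kappa>(x',y') \<le> \<kappa>(x,x') + \<kappa>(y',y) \<le> L (\<rho>(x,x') + \<rho>(y,y'))\<close>,
  and the same holds with the two points exchanged. The bracket is at most \<open>2 (\<rho> \<oplus> \<rho>)\<close> for every
  choice of \<open>\<rho> \<oplus> \<rho>\<close>, and it is \<open>\<rho> \<oplus> \<rho>\<close> itself for the choice \<open>p = 1\<close>. In that case both
  directions preserve the constant \<open>L\<close>, so \<open>Lip(\<kappa>)\<close> and \<open>Lip(\<iota>\<^sub>\<sigma>\<inverse>)\<close> are the least elements of the
  same set.
\<close>

lemma rho_nonneg: "0 \<le> rho M s x y"
  by (simp add: rho_def L2_norm_def)

lemma rho_refl: "rho M s x x = 0"
  by (simp add: rho_def L2_norm_def)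

lemma rho_sym: "rho M s x y = rho M s y x"
  by (simp add: rho_def L2_norm_def power2_commute)

lemma oplus_p_1:
  assumes "\<And>x y. 0 \<le> r x y"
  shows "oplus_p 1 r u v = r (fst u) (fst v) + r (snd u) (snd v)"
  using assms by (simp add: oplus_p_def)

lemma oplus_same_snd:
  assumes "d \<in> oplus_pseudometrics r"
    and "\<And>x y. 0 \<le> r x y" and "\<And>x. r x x = 0"
  shows "d (x, z) (y, z) = r x y"
  using assms by (auto simp: oplus_pseudometrics_def oplus_max_def oplus_p_def powr_powr)

text \<open>The maximum is the smallest of the pseudometrics \<open>\<rho> \<oplus> \<rho>\<close>, and a sum of two terms is at
  most twice their maximum.\<close>

lemma sum_le_twice_oplus:
  assumes d: "d \<in> oplus_pseudometrics r" and nonneg: "\<And>x y. 0 \<le> r x y"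
  shows "r (fst u) (fst v) + r (snd u) (snd v) \<le> 2 * d u v"
proof -
  have le_p_sum: "a \<le> (a powr p + b powr p) powr (1 / p)" if "0 \<le> a" "1 \<le> p" for a b p :: real
  proof -
    have "a = (a powr p) powr (1 / p)"
      using that by (simp add: powr_powr)
    also have "\<dots> \<le> (a powr p + b powr p) powr (1 / p)"
      using that by (intro powr_mono2) auto
    finally show ?thesis .
  qed
  have "r (fst u) (fst v) \<le> d u v \<and> r (snd u) (snd v) \<le> d u v"
    using d le_p_sum nonneg
    by (auto simp: oplus_pseudometrics_def oplus_max_def oplus_p_def)
       (metis add.commute le_p_sum nonneg)
  then show ?thesis by simp
qed

text \<open>Moving each coordinate separately costs one triangle inequality; the symmetry of \<open>r\<close> makes up
  for \<open>k\<close> not being symmetric.\<close>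

lemma dominated_distance_change_bound:
  assumes dist: "is_distance X k"
    and dom: "\<forall>x\<in>X. \<forall>y\<in>X. k x y \<le> C * r x y"
    and sym: "\<And>x y. r x y = r y x"
    and X: "x \<in> X" "y \<in> X" "x' \<in> X" "y' \<in> X"
  shows "\<bar>k x y - k x' y'\<bar> \<le> C * (r x x' + r y y')"
proof -
  have one_sided: "k a b - k a' b' \<le> C * (r a a' + r b b')"
    if "a \<in> X" "b \<in> X" "a' \<in> X" "b' \<in> X" for a b a' b'
  proof -
    have "k a b \<le> k a a' + k a' b" "k a' b \<le> k a' b' + k b' b"
      using dist that by (auto simp: is_distance_def)
    moreover have "k a a' \<le> C * r a a'" "k b' b \<le> C * r b b'"
      using dom that sym[of b b'] by auto
    ultimately show ?thesis by (simp add: distrib_left)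
  qed
  show ?thesis
    using one_sided[of x y x' y'] one_sided[of x' y' x y] X sym[of x x'] sym[of y y'] by auto
qed

lemma Lipschitz_const_imp_dominated:
  assumes d: "d \<in> oplus_pseudometrics r"
    and nonneg: "\<And>x y. 0 \<le> r x y" and refl: "\<And>x. r x x = 0"
    and diag: "\<forall>x\<in>X. k x x = 0"
    and lip: "Lipschitz_const (X \<times> X) d (case_prod k) L"
  shows "\<forall>x\<in>X. \<forall>y\<in>X. k x y \<le> L * r x y"
proof (intro ballI)
  fix x y assume xy: "x \<in> X" "y \<in> X"
  have "dist (k x y) (k y y) \<le> L * d (x, y) (y, y)"
    using lip xy by (force simp: Lipschitz_const_def)
  then show "k x y \<le> L * r x y"
    using diag xy oplus_same_snd[OF d nonneg refl] by (simp add: dist_real_def)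
qed

lemma dominated_imp_Lipschitz_const:
  assumes d: "d \<in> oplus_pseudometrics r"
    and nonneg: "\<And>x y. 0 \<le> r x y" and sym: "\<And>x y. r x y = r y x"
    and dist: "is_distance X k" and C: "0 \<le> C"
    and dom: "\<forall>x\<in>X. \<forall>y\<in>X. k x y \<le> C * r x y"
  shows "Lipschitz_const (X \<times> X) d (case_prod k) (2 * C)"
  unfolding Lipschitz_const_def
proof (intro conjI ballI)
  show "0 \<le> 2 * C" using C by simp
  fix u v assume uv: "u \<in> X \<times> X" "v \<in> X \<times> X"
  have "dist (case_prod k u) (case_prod k v) \<le> C * (r (fst u) (fst v) + r (snd u) (snd v))"
    using uv dominated_distance_change_bound[OF dist dom sym]
    by (auto simp: dist_real_def)
  also have "\<dots> \<le> C * (2 * d u v)"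
    using sum_le_twice_oplus[OF d nonneg] C by (intro mult_left_mono)
  finally show "dist (case_prod k u) (case_prod k v) \<le> 2 * C * d u v"
    by (simp add: mult_ac)
qed

text \<open>The change of \<open>k\<close> is bounded by a multiple of the sum itself, so no factor \<open>2\<close> is lost here.
  This is what makes the two smallest constants agree.\<close>

lemma Lipschitz_const_oplus_1_iff_dominated:
  assumes nonneg: "\<And>x y. 0 \<le> r x y" and refl: "\<And>x. r x x = 0"
    and sym: "\<And>x y. r x y = r y x"
    and dist: "is_distance X k" and diag: "\<forall>x\<in>X. k x x = 0"
  shows "Lipschitz_const (X \<times> X) (oplus_p 1 r) (case_prod k) L \<longleftrightarrow>
    0 \<le> L \<and> (\<forall>x\<in>X. \<forall>y\<in>X. k x y \<le> L * r x y)"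
proof
  have "oplus_p 1 r \<in> oplus_pseudometrics r"
    by (auto simp: oplus_pseudometrics_def)
  moreover assume "Lipschitz_const (X \<times> X) (oplus_p 1 r) (case_prod k) L"
  ultimately show "0 \<le> L \<and> (\<forall>x\<in>X. \<forall>y\<in>X. k x y \<le> L * r x y)"
    using Lipschitz_const_imp_dominated[of _ r X k L] nonneg refl diag
    by (auto simp: Lipschitz_const_def)
next
  assume L: "0 \<le> L \<and> (\<forall>x\<in>X. \<forall>y\<in>X. k x y \<le> L * r x y)"
  then show "Lipschitz_const (X \<times> X) (oplus_p 1 r) (case_prod k) L"
    using dominated_distance_change_bound[OF dist _ sym, of L]
    by (auto simp: Lipschitz_const_def dist_real_def oplus_p_1[of r, OF nonneg])
qed

text \<open>The maximum in the definition of a lower Lipschitz map is absorbed by the symmetry of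
  \<open>rho\<close>, and its constant \<open>l\<close> is inverse to the domination constant.\<close>

lemma lower_Lipschitz_iff_dominated:
  "lower_Lipschitz M k s \<longleftrightarrow>
    (\<exists>C\<ge>0. \<forall>x\<in>space M. \<forall>y\<in>space M. k x y \<le> C * rho M s x y)"
proof
  assume "lower_Lipschitz M k s"
  then obtain l where l: "0 < l"
    "\<forall>x\<in>space M. \<forall>y\<in>space M. l * max (k x y) (k y x) \<le> rho M s x y"
    by (auto simp: lower_Lipschitz_def)
  have "k x y \<le> inverse l * rho M s x y" if "x \<in> space M" "y \<in> space M" for x y
  proof -
    have "l * k x y \<le> l * max (k x y) (k y x)"
      using l(1) by (intro mult_left_mono) auto
    also have "\<dots> \<le> rho M s x y" using l(2) that by auto
    finally show ?thesis using l(1) by (simp add: field_simps)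
  qed
  then show "\<exists>C\<ge>0. \<forall>x\<in>space M. \<forall>y\<in>space M. k x y \<le> C * rho M s x y"
    using l(1) by (intro exI[of _ "inverse l"]) auto
next
  assume "\<exists>C\<ge>0. \<forall>x\<in>space M. \<forall>y\<in>space M. k x y \<le> C * rho M s x y"
  then obtain C where C: "0 \<le> C"
    "\<And>x y. x \<in> space M \<Longrightarrow> y \<in> space M \<Longrightarrow> k x y \<le> C * rho M s x y"
    by auto
  \<comment> \<open>The summand \<open>1\<close> keeps the inverse positive when \<open>C = 0\<close>.\<close>
  have "inverse (C + 1) * max (k x y) (k y x) \<le> rho M s x y"
    if xy: "x \<in> space M" "y \<in> space M" for x y
  proof -
    have "max (k x y) (k y x) \<le> C * rho M s x y"
      using C(2)[OF xy] C(2)[OF xy(2,1)] by (simp add: rho_sym[of M s y x])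
    also have "\<dots> \<le> (C + 1) * rho M s x y"
      using rho_nonneg by (intro mult_right_mono) auto
    finally show ?thesis using C(1) by (simp add: field_simps)
  qed
  then show "lower_Lipschitz M k s"
    using C(1) unfolding lower_Lipschitz_def by (intro exI[of _ "inverse (C + 1)"]) auto
qed

theorem corollary5p1:
  fixes M :: "'a measure" and k s :: "'a \<Rightarrow> 'a \<Rightarrow> real"
  assumes "prob_space M"
    and "k \<in> nonneg_kernels M \<inter> diag0_kernels M"
    and "is_distance (space M) k"
    and "s \<in> nonneg_kernels M"
  shows "(\<forall>d \<in> oplus_pseudometrics (rho M s).
            is_Lipschitz (space M \<times> space M) d (case_prod k) \<longleftrightarrow> lower_Lipschitz M k s)
       \<and> (lower_Lipschitz M k s \<longrightarrow>
            Lip (space M \<times> space M) (oplus_p 1 (rho M s)) (case_prod k) = Lip_inverse M k s)"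
proof (intro conjI ballI impI)
  have diag: "\<forall>x\<in>space M. k x x = 0"
    using assms(2) by (simp add: diag0_kernels_def)
  show "is_Lipschitz (space M \<times> space M) d (case_prod k) \<longleftrightarrow> lower_Lipschitz M k s"
    if d: "d \<in> oplus_pseudometrics (rho M s)" for d
  proof
    assume "is_Lipschitz (space M \<times> space M) d (case_prod k)"
    then obtain L where L: "Lipschitz_const (space M \<times> space M) d (case_prod k) L"
      by (auto simp: is_Lipschitz_def)
    show "lower_Lipschitz M k s"
      using Lipschitz_const_imp_dominated[OF d rho_nonneg rho_refl diag L] L
      by (auto simp: lower_Lipschitz_iff_dominated Lipschitz_const_def)
  next
    assume "lower_Lipschitz M k s"
    then show "is_Lipschitz (space M \<times> space M) d (case_prod k)"
      using dominated_imp_Lipschitz_const[OF d rho_nonneg rho_sym assms(3)]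
      by (auto simp: lower_Lipschitz_iff_dominated is_Lipschitz_def)
  qed
  show "Lip (space M \<times> space M) (oplus_p 1 (rho M s)) (case_prod k) = Lip_inverse M k s"
    unfolding Lip_def Lip_inverse_def
      Lipschitz_const_oplus_1_iff_dominated[OF rho_nonneg rho_refl rho_sym assms(3) diag] ..
qed

end
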